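(* Let $\mathcal{S}$ be a semilinear set system on $\mathbb{R}^m$ parameterized by $Y \subseteq \mathbb{R}^n$. Then there exist constants $C_1, C_2 > 0$ and an integer $0 \leq s \leq n$ such that \[ C_1 t^{s} < \pi_{\mathcal{S}}(t) < C_2 t^{s} \quad \text{for every integer } t \geq 1. \]
   Context: A semilinear set in $\mathbb{R}^k$ is a finite union of solution sets of finite systems of linear equations and (strict or non-strict) linear inequalities with real coefficients. A set system $\mathcal{S}$ on $\mathbb{R}^m$ parameterized by $Y \subseteq \mathbb{R}^n$ is semilinear if $\mathcal{S} = \{S_b \subseteq \mathbb{R}^m : b \in Y\}$ where both $Y$ and $Z = \{(a,b) \in \mathbb{R}^m \times \mathbb{R}^n : a \in S_b,\ b \in Y\}$ are semilinear. For a set system $\mathcal{S}$ on a set $V$ and $A \subseteq V$, the trace is $\mathcal{S} \cap A = \{S \cap A : S \in \mathcal{S}\}$, and the shatter function is $\pi_{\mathcal{S}}(t) = \max\{|\mathcal{S} \cap A| : A \subseteq V,\ |A| = t\}$.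
   Formalization: The parameter set Y is assumed nonempty: for empty Y the system is empty, its shatter function is 0 and the strict lower bound fails; m and n are taken to be at least 1. *)

theory Defs
  imports "HOL-Analysis.Analysis"
begin

text \<open>
  A linear equation or inequality over a Euclidean space is a pair \<open>(a, c)\<close> of a
  coefficient vector and a constant term, read as \<open>a \<bullet> x = c\<close>, \<open>a \<bullet> x \<le> c\<close> or
  \<open>a \<bullet> x < c\<close>; the converse inequalities are obtained by negating \<open>a\<close> and \<open>c\<close>.
  On the product \<open>\<real>\<^sup>m \<times> \<real>\<^sup>n\<close> the inner product is
  \<open>(a, b) \<bullet> (x, y) = a \<bullet> x + b \<bullet> y\<close>, so that the case of \<open>\<real>\<^sup>m\<^sup>+\<^sup>n\<close> is covered.
\<close>

definition linear_system_set :: "'a::euclidean_space set \<Rightarrow> bool" where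
  "linear_system_set P \<longleftrightarrow>
     (\<exists>E W L :: ('a \<times> real) set. finite E \<and> finite W \<and> finite L \<and>
        P = {x. (\<forall>(a, c)\<in>E. a \<bullet> x = c) \<and> (\<forall>(a, c)\<in>W. a \<bullet> x \<le> c) \<and> (\<forall>(a, c)\<in>L. a \<bullet> x < c)})"

definition semilinear :: "'a::euclidean_space set \<Rightarrow> bool" where
  "semilinear X \<longleftrightarrow> (\<exists>F. finite F \<and> (\<forall>P\<in>F. linear_system_set P) \<and> X = \<Union>F)"

definition semilinear_set_system :: "(real ^ 'm) set set \<Rightarrow> (real ^ 'n) set \<Rightarrow> bool" where
  "semilinear_set_system \<S> Y \<longleftrightarrow>
     (\<exists>S :: real ^ 'n \<Rightarrow> (real ^ 'm) set.
        \<S> = {S b | b. b \<in> Y} \<and> semilinear Y \<and> semilinear {(a, b). a \<in> S b \<and> b \<in> Y})"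

definition trace_on :: "'a set set \<Rightarrow> 'a set \<Rightarrow> 'a set set" where
  "trace_on \<S> A = {S \<inter> A | S. S \<in> \<S>}"

text \<open>
  Each trace on a set of size \<open>t\<close> has at most \<open>2\<^sup>t\<close> members, so the maximum below is over
  a finite set; it is nonempty whenever \<open>V\<close> is infinite.  The guard \<open>finite A\<close> matters
  only for \<open>t = 0\<close>, because infinite sets have \<open>card\<close> zero.
\<close>

definition shatter_function :: "'a set \<Rightarrow> 'a set set \<Rightarrow> nat \<Rightarrow> nat" where
  "shatter_function V \<S> t = Max {card (trace_on \<S> A) | A. A \<subseteq> V \<and> finite A \<and> card A = t}"

end

theory Submission
  imports Defs
begin

text \<open>
  Membership of \<open>a\<close> in \<open>S b\<close> depends only on the signs of finitely many affine forms in \<open>(a, b)\<close>.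
  Eliminating \<open>a\<close> (Fourier--Motzkin) gives finitely many affine forms in \<open>b\<close> alone such that all
  parameters of one cell of the corresponding arrangement realise the same sign vectors. Let \<open>s\<close> be
  the largest number of points \<open>a\<^sub>1, \<dots>, a\<^sub>s\<close> such that, at some parameter \<open>b0\<close> and for some
  cell with \<open>b0\<close> in its closure, each \<open>a\<^sub>j\<close> admits a direction in the parameter space, keeping the
  cell of \<open>b0\<close>, that locally affects membership of points near \<open>a\<^sub>j\<close> but not near the others. Such
  directions are linearly independent, so \<open>s \<le> n\<close>.

  Lower bound: a shift of \<open>b\<close> along the \<open>j\<close>-th direction can be undone by a shift of \<open>a\<^sub>j\<close>, so
  placing \<open>k\<close> shifted copies near each \<open>a\<^sub>j\<close> gives \<open>k\<^sup>s\<close> traces on \<open>s k\<close> points.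

  Upper bound: for a trace \<open>X\<close> on \<open>A\<close> take a point \<open>b0\<close> of minimal norm in the closure of the set of
  parameters of one cell having trace \<open>X\<close>. It is orthogonal to the space of directions leaving the
  local picture at every point of \<open>A\<close> unchanged. A minimal subset of \<open>A\<close> defining this space has at
  most \<open>s\<close> elements, and together with bounded information it determines \<open>b0\<close> and then \<open>X\<close>.
\<close>

section \<open>Sign vectors of affine forms and their local behaviour\<close>

text \<open>A pair \<open>h\<close> stands for the affine form with linear part \<open>fst h\<close>
  and constant \<open>- snd h\<close>. The value 0 off \<open>H\<close> makes equality of functions
  the same as agreement on \<open>H\<close>.\<close>

definition signs :: "('e::real_inner \<times> real) set \<Rightarrow> 'e \<Rightarrow> 'e \<times> real \<Rightarrow> real" where
  "signs H z = (\<lambda>h. if h \<in> H then sgn (fst h \<bullet> z - snd h) else 0)"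

text \<open>
  If \<open>\<sigma>\<close> is the sign vector at \<open>z\<^sub>0\<close>, then \<open>germ_signs H \<sigma> z\<close> is the sign vector
  at \<open>z\<^sub>0 + \<epsilon> z\<close> for all small \<open>\<epsilon> > 0\<close> (the composition of covectors of oriented matroids).
\<close>
definition germ_signs ::
    "('e::real_inner \<times> real) set \<Rightarrow> ('e \<times> real \<Rightarrow> real) \<Rightarrow> 'e \<Rightarrow> 'e \<times> real \<Rightarrow> real" where
  "germ_signs H \<sigma> z = (\<lambda>h. if h \<in> H then if \<sigma> h = 0 then sgn (fst h \<bullet> z) else \<sigma> h else 0)"

lemma signs_eq_iff:
  "signs H z = signs H z' \<longleftrightarrow> (\<forall>h\<in>H. sgn (fst h \<bullet> z - snd h) = sgn (fst h \<bullet> z' - snd h))"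
  by (auto simp: signs_def fun_eq_iff)

lemma signs_eq_mono: "signs H z = signs H z' \<Longrightarrow> G \<subseteq> H \<Longrightarrow> signs G z = signs G z'"
  by (auto simp: signs_eq_iff)

lemma signs_eq_0_iff: "signs H z h = 0 \<longleftrightarrow> h \<notin> H \<or> fst h \<bullet> z = snd h"
  by (simp add: signs_def sgn_0_0)

definition sign_vectors :: "'h set \<Rightarrow> ('h \<Rightarrow> real) set" where
  "sign_vectors H = {\<sigma>. \<forall>h. (h \<in> H \<longrightarrow> \<sigma> h \<in> {-1, 0, 1}) \<and> (h \<notin> H \<longrightarrow> \<sigma> h = 0)}"

lemma finite_sign_vectors: "finite H \<Longrightarrow> finite (sign_vectors H)"
  unfolding sign_vectors_def by (intro finite_set_of_finite_funs) auto

lemma sgn_cases: "sgn (x::real) \<in> {-1, 0, 1}"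
  by (auto simp: sgn_if)

lemma signs_in_sign_vectors: "signs H z \<in> sign_vectors H"
  using sgn_cases by (auto simp: sign_vectors_def signs_def)

lemma germ_signs_scale: "c > 0 \<Longrightarrow> germ_signs H \<sigma> (c *\<^sub>R z) = germ_signs H \<sigma> z"
  by (auto simp: germ_signs_def fun_eq_iff sgn_mult)

lemma eventually_sgn_form:
  fixes z0 :: "'e::real_inner"
  shows "\<forall>\<^sub>F z in nhds z0. sgn (p \<bullet> z - c) = (if p \<bullet> z0 = c then sgn (p \<bullet> (z - z0)) else sgn (p \<bullet> z0 - c))"
proof -
  have t: "((\<lambda>z. p \<bullet> z - c) \<longlongrightarrow> p \<bullet> z0 - c) (nhds z0)"
    by (intro tendsto_intros filterlim_ident)
  consider "p \<bullet> z0 = c" | "p \<bullet> z0 - c < 0" | "p \<bullet> z0 - c > 0" by linarith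
  then show ?thesis
  proof cases
    case 1
    then show ?thesis by (auto simp: inner_diff_right)
  next
    case 2
    then show ?thesis
      using order_tendstoD(2)[OF t 2] by (auto elim!: eventually_mono)
  next
    case 3
    then show ?thesis
      using order_tendstoD(1)[OF t 3] by (auto elim!: eventually_mono)
  qed
qed

lemma eventually_signs:
  assumes "finite H"
  shows "\<forall>\<^sub>F z in nhds z0. signs H z = germ_signs H (signs H z0) (z - z0)"
proof -
  have "\<forall>\<^sub>F z in nhds z0. \<forall>h\<in>H. sgn (fst h \<bullet> z - snd h) =
      (if fst h \<bullet> z0 = snd h then sgn (fst h \<bullet> (z - z0)) else sgn (fst h \<bullet> z0 - snd h))"
    using assms eventually_sgn_form by (intro eventually_ball_finite) blast+
  then show ?thesis
    by eventually_elim (auto simp: signs_def germ_signs_def fun_eq_iff sgn_0_0)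
qed

text \<open>Where \<open>\<sigma>\<close> vanishes, the germ is the sign of a linear form, so the
  local expansion of affine forms applies to it again, now with constant term 0.\<close>

lemma eventually_germ_signs:
  assumes "finite H"
  shows "\<forall>\<^sub>F z in nhds z0. germ_signs H \<sigma> z = germ_signs H (germ_signs H \<sigma> z0) (z - z0)"
proof -
  have "\<forall>\<^sub>F z in nhds z0. \<forall>h\<in>H. sgn (fst h \<bullet> z - 0) =
      (if fst h \<bullet> z0 = 0 then sgn (fst h \<bullet> (z - z0)) else sgn (fst h \<bullet> z0 - 0))"
    using assms eventually_sgn_form by (intro eventually_ball_finite) blast+
  then show ?thesis
    by eventually_elim (auto simp: germ_signs_def fun_eq_iff sgn_0_0)
qed

lemma filterlim_ray: "filterlim (\<lambda>\<epsilon>. z0 + \<epsilon> *\<^sub>R z) (nhds (z0::'e::real_normed_vector)) (at_right 0)"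
proof -
  have "((\<lambda>\<epsilon>. z0 + \<epsilon> *\<^sub>R z) \<longlongrightarrow> z0 + 0 *\<^sub>R z) (at_right 0)"
    by (intro tendsto_intros)
  then show ?thesis by simp
qed

lemma eventually_signs_ray:
  assumes "finite H"
  shows "\<forall>\<^sub>F \<epsilon> in at_right 0. signs H (z0 + \<epsilon> *\<^sub>R z) = germ_signs H (signs H z0) z"
  using filterlim_ray[of z0 z, unfolded filterlim_iff, rule_format, OF eventually_signs[OF assms, of z0]]
    eventually_at_right_less[of "0::real"]
  by eventually_elim (simp add: germ_signs_scale)

lemma eventually_germ_signs_ray:
  assumes "finite H"
  shows "\<forall>\<^sub>F \<epsilon> in at_right 0. germ_signs H \<sigma> (z0 + \<epsilon> *\<^sub>R z) = germ_signs H (germ_signs H \<sigma> z0) z"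
  using filterlim_ray[of z0 z, unfolded filterlim_iff, rule_format, OF eventually_germ_signs[OF assms, of \<sigma> z0]]
    eventually_at_right_less[of "0::real"]
  by eventually_elim (simp add: germ_signs_scale)

section \<open>Semilinear sets as unions of sign cells\<close>

lemma linear_system_set_signs:
  assumes "linear_system_set P"
  shows "\<exists>H. finite H \<and> (\<forall>z z'. signs H z = signs H z' \<longrightarrow> z \<in> P \<longrightarrow> z' \<in> P)"
proof -
  obtain E W L where fin: "finite E" "finite W" "finite L"
    and P: "P = {x. (\<forall>(a, c)\<in>E. a \<bullet> x = c) \<and> (\<forall>(a, c)\<in>W. a \<bullet> x \<le> c) \<and> (\<forall>(a, c)\<in>L. a \<bullet> x < c)}"
    using assms unfolding linear_system_set_def by blast
  have "z' \<in> P" if eq: "signs (E \<union> W \<union> L) z = signs (E \<union> W \<union> L) z'" and z: "z \<in> P" for z z'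
  proof -
    have s: "sgn (a \<bullet> z - c) = sgn (a \<bullet> z' - c)" if "(a, c) \<in> E \<union> W \<union> L" for a c
      using eq that by (force simp: signs_eq_iff)
    have "a \<bullet> z' = c" if "(a, c) \<in> E" for a c
      using s[of a c] that z by (force simp: P sgn_0_0)
    moreover have "a \<bullet> z' \<le> c" if "(a, c) \<in> W" for a c
    proof -
      have "a \<bullet> z \<le> c" using that z by (force simp: P)
      then show ?thesis using s[of a c] that by (auto simp: sgn_if split: if_splits)
    qed
    moreover have "a \<bullet> z' < c" if "(a, c) \<in> L" for a c
    proof -
      have "a \<bullet> z < c" using that z by (force simp: P)
      then show ?thesis using s[of a c] that by (auto simp: sgn_if split: if_splits)
    qed
    ultimately show ?thesis by (auto simp: P)
  qed
  then show ?thesis using fin by (intro exI[of _ "E \<union> W \<union> L"]) blast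
qed

lemma semilinear_signs:
  assumes "semilinear X"
  shows "\<exists>H. finite H \<and> (\<forall>z z'. signs H z = signs H z' \<longrightarrow> z \<in> X \<longrightarrow> z' \<in> X)"
proof -
  obtain F where F: "finite F" "\<And>P. P \<in> F \<Longrightarrow> linear_system_set P" "X = \<Union>F"
    using assms unfolding semilinear_def by blast
  then obtain H where H: "\<And>P. P \<in> F \<Longrightarrow> finite (H P)"
    "\<And>P z z'. P \<in> F \<Longrightarrow> signs (H P) z = signs (H P) z' \<Longrightarrow> z \<in> P \<Longrightarrow> z' \<in> P"
    using linear_system_set_signs by metis
  have "z' \<in> X" if eq: "signs (\<Union>(H ` F)) z = signs (\<Union>(H ` F)) z'" and z: "z \<in> X" for z z'
  proof -
    obtain P where P: "P \<in> F" "z \<in> P" using z F(3) by blast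
    have "signs (H P) z = signs (H P) z'"
      using eq by (rule signs_eq_mono) (use P in blast)
    then show ?thesis using H(2) P F(3) by blast
  qed
  then show ?thesis using F(1) H(1) by (intro exI[of _ "\<Union>(H ` F)"]) blast
qed

section \<open>Fourier--Motzkin elimination for sign vectors\<close>

text \<open>The roots cut the line into points and open intervals. The order type of the roots
  determines which of these cells occur, and each open one is nonempty because the line is dense and
  unbounded.\<close>

lemma order_type_extend_point:
  fixes r r' :: "'i \<Rightarrow> real"
  assumes fin: "finite I" and ord: "\<And>i j. i \<in> I \<Longrightarrow> j \<in> I \<Longrightarrow> sgn (r i - r j) = sgn (r' i - r' j)"
  shows "\<exists>x'. \<forall>i\<in>I. sgn (x - r i) = sgn (x' - r' i)"
proof (cases "\<exists>i\<in>I. x = r i")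
  case True
  then show ?thesis using ord by blast
next
  case False
  define L U where "L = r' ` {i\<in>I. r i < x}" and "U = r' ` {i\<in>I. x < r i}"
  have fLU: "finite L" "finite U" using fin by (auto simp: L_def U_def)
  have LU: "l < u" if l: "l \<in> L" and u: "u \<in> U" for l u
  proof -
    obtain i j where ij: "i \<in> I" "j \<in> I" "r i < x" "x < r j" "l = r' i" "u = r' j"
      using l u by (auto simp: L_def U_def)
    with ord[of i j] show ?thesis by (auto simp: sgn_if split: if_splits)
  qed
  obtain x' where x': "\<And>l. l \<in> L \<Longrightarrow> l < x'" "\<And>u. u \<in> U \<Longrightarrow> x' < u"
  proof (cases "L = {}")
    case True
    have "\<exists>x'. \<forall>u\<in>U. x' < u"
    proof (cases "U = {}")
      case False
      then show ?thesis using fLU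
        by (intro exI[of _ "Min U - 1"]) (auto intro: less_le_trans[OF _ Min_le] dest: Min_le)
    qed auto
    with True that show ?thesis by blast
  next
    case L: False
    show ?thesis
    proof (cases "U = {}")
      case True
      have "l < Max L + 1" if "l \<in> L" for l using Max_ge[OF fLU(1) that] by linarith
      with True that show ?thesis by blast
    next
      case False
      have "Max L < Min U" using LU L False fLU by simp
      then obtain x' where "Max L < x'" "x' < Min U" using dense by blast
      then have "\<forall>l\<in>L. l < x'" "\<forall>u\<in>U. x' < u" using L False fLU by simp_all
      then show ?thesis using that by blast
    qed
  qed
  have "sgn (x - r i) = sgn (x' - r' i)" if "i \<in> I" for i
    using x'(1)[of "r' i"] x'(2)[of "r' i"] that False
    by (cases "r i < x") (auto simp: L_def U_def sgn_if not_less order_le_less)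
  then show ?thesis by blast
qed

text \<open>On a line in direction \<open>e\<close>, a form with nonzero slope has exactly one root,
  so the sign vector depends on the position of \<open>x\<close> among the roots. The order of two
  roots is itself the sign of an affine form in \<open>z\<close>.\<close>

lemma signs_eliminate_direction:
  assumes "finite H"
  shows "\<exists>H'. finite H' \<and> (\<forall>z z'. signs H' z = signs H' z' \<longrightarrow>
            (\<forall>x. \<exists>x'. signs H (z + x *\<^sub>R e) = signs H (z' + x' *\<^sub>R e)))"
proof -
  define I where "I = {h\<in>H. fst h \<bullet> e \<noteq> 0}"
  \<comment> \<open>Both forms are scaled to slope 1 along \<open>e\<close> and subtracted; the
    value at \<open>y\<close> is the difference \<open>root y k - root y h\<close>.\<close>
  define diff where "diff = (\<lambda>(h::'a \<times> real) (k::'a \<times> real).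
    (fst h /\<^sub>R (fst h \<bullet> e) - fst k /\<^sub>R (fst k \<bullet> e), snd h / (fst h \<bullet> e) - snd k / (fst k \<bullet> e)))"
  \<comment> \<open>Keeping \<open>H\<close> takes care of the forms that are constant along
    \<open>e\<close>.\<close>
  define H' where "H' = H \<union> (\<lambda>(h, k). diff h k) ` (I \<times> I)"
  define root where "root = (\<lambda>z (h::'a \<times> real). (snd h - fst h \<bullet> z) / (fst h \<bullet> e))"
  have finI: "finite I" using assms by (simp add: I_def)
  have "\<exists>x'. signs H (z + x *\<^sub>R e) = signs H (z' + x' *\<^sub>R e)" if eq: "signs H' z = signs H' z'" for z z' x
  proof -
    have *: "fst (diff h k) \<bullet> y - snd (diff h k) = root y k - root y h" for h k y
      by (simp add: diff_def root_def inner_diff_left diff_divide_distrib divide_inverse algebra_simps)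
    have "sgn (root z k - root z h) = sgn (root z' k - root z' h)" if "h \<in> I" "k \<in> I" for h k
    proof -
      have "diff h k \<in> H'" using that by (auto simp: H'_def)
      then have "sgn (fst (diff h k) \<bullet> z - snd (diff h k)) = sgn (fst (diff h k) \<bullet> z' - snd (diff h k))"
        using eq by (simp add: signs_eq_iff)
      then show ?thesis by (simp add: *)
    qed
    then obtain x' where x': "\<And>h. h \<in> I \<Longrightarrow> sgn (x - root z h) = sgn (x' - root z' h)"
      using order_type_extend_point[OF finI, of "root z" "root z'" x] by blast
    have "sgn (fst h \<bullet> (z + x *\<^sub>R e) - snd h) = sgn (fst h \<bullet> (z' + x' *\<^sub>R e) - snd h)" if h: "h \<in> H" for h
    proof (cases "fst h \<bullet> e = 0")
      case True
      then show ?thesis using eq h by (simp add: signs_eq_iff H'_def inner_add_right)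
    next
      case False
      have "fst h \<bullet> (y + \<xi> *\<^sub>R e) - snd h = (fst h \<bullet> e) * (\<xi> - root y h)" for y \<xi>
        using False by (simp add: root_def inner_add_right right_diff_distrib del: times_divide_eq_right)
          (simp add: mult.commute)
      then show ?thesis using x'[of h] h False by (simp add: I_def sgn_mult)
    qed
    then show ?thesis by (auto simp: signs_eq_iff)
  qed
  moreover have "finite H'" using assms finI by (simp add: H'_def)
  ultimately show ?thesis by blast
qed

lemma signs_eliminate_span:
  assumes "finite B" "finite H"
  shows "\<exists>H'. finite H' \<and> (\<forall>z z'. signs H' z = signs H' z' \<longrightarrow>
            (\<forall>y\<in>span B. \<exists>y'\<in>span B. signs H (z + y) = signs H (z' + y')))"
  using assms(1)
proof (induction B rule: finite_induct)
  case empty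
  then show ?case using assms(2) by auto
next
  case (insert e B)
  then obtain H1 where H1: "finite H1"
    "\<And>z z' y. signs H1 z = signs H1 z' \<Longrightarrow> y \<in> span B \<Longrightarrow> \<exists>y'\<in>span B. signs H (z + y) = signs H (z' + y')"
    by blast
  obtain H2 where H2: "finite H2"
    "\<And>z z' x. signs H2 z = signs H2 z' \<Longrightarrow> \<exists>x'. signs H1 (z + x *\<^sub>R e) = signs H1 (z' + x' *\<^sub>R e)"
    using signs_eliminate_direction[OF H1(1), of e] by metis
  have "\<exists>y'\<in>span (insert e B). signs H (z + y) = signs H (z' + y')"
    if eq: "signs H2 z = signs H2 z'" and y: "y \<in> span (insert e B)" for z z' y
  proof -
    obtain x where x: "y - x *\<^sub>R e \<in> span B" using y unfolding span_insert by blast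
    obtain x' where "signs H1 (z + x *\<^sub>R e) = signs H1 (z' + x' *\<^sub>R e)" using H2(2)[OF eq] by blast
    then obtain y' where y': "y' \<in> span B"
      "signs H (z + x *\<^sub>R e + (y - x *\<^sub>R e)) = signs H (z' + x' *\<^sub>R e + y')"
      using H1(2) x by blast
    have "x' *\<^sub>R e + y' \<in> span (insert e B)"
      using y'(1) span_mono[of B "insert e B"] by (intro span_add span_scale) (auto intro: span_base)
    moreover have "signs H (z + y) = signs H (z' + (x' *\<^sub>R e + y'))"
      using y'(2) by (simp add: add.assoc)
    ultimately show ?thesis by blast
  qed
  then show ?case using H2(1) by blast
qed

text \<open>The fibre over \<open>b\<close> is the translate of the first factor by
  \<open>(0, b)\<close>, so eliminating a basis of that factor compares whole fibres.\<close>

lemma signs_eliminate_fst: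
  fixes H :: "(('a::euclidean_space \<times> 'b::euclidean_space) \<times> real) set"
  assumes "finite H"
  shows "\<exists>Q. finite Q \<and> (\<forall>b b'. signs Q b = signs Q b' \<longrightarrow>
            (\<forall>a. \<exists>a'. signs H (a', b') = signs H (a, b)))"
proof -
  define B :: "('a \<times> 'b) set" where "B = (\<lambda>e. (e, 0)) ` Basis"
  have lin: "linear (\<lambda>e::'a. (e, 0::'b))"
    by (intro linearI) auto
  have span: "span B = (\<lambda>e. (e, 0)) ` UNIV"
    unfolding B_def linear_span_image[OF lin] by simp
  obtain H' where H': "finite H'" "\<And>z z' y. signs H' z = signs H' z' \<Longrightarrow> y \<in> span B \<Longrightarrow>
      \<exists>y'\<in>span B. signs H (z + y) = signs H (z' + y')"
    using signs_eliminate_span[of B H] assms unfolding B_def by (metis finite_Basis finite_imageI)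
  \<comment> \<open>Fibres may be compared from their points with first component 0, where the
    eliminated forms depend on the parameter alone.\<close>
  define Q where "Q = (\<lambda>h. (snd (fst h), snd h)) ` H'"
  have "\<exists>a'. signs H (a', b') = signs H (a, b)" if eq: "signs Q b = signs Q b'" for a b b'
  proof -
    have "signs H' (0, b) = signs H' (0, b')"
      using eq by (auto simp: signs_eq_iff Q_def inner_prod_def)
    moreover have "(a, 0) \<in> span B" by (simp add: span)
    ultimately obtain y' where "y' \<in> span B" "signs H ((0, b) + (a, 0)) = signs H ((0, b') + y')"
      using H'(2) by blast
    then show ?thesis by (auto simp: span)
  qed
  then show ?thesis using H'(1) by (intro exI[of _ Q]) (auto simp: Q_def)
qed

section \<open>Traces and the shatter function\<close>

lemma trace_on_subset_Pow: "trace_on \<S> A \<subseteq> Pow A"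
  by (auto simp: trace_on_def)

lemma finite_trace_on: "finite A \<Longrightarrow> finite (trace_on \<S> A)"
  using trace_on_subset_Pow by (rule finite_subset) simp

lemma card_trace_on_mono:
  assumes "A \<subseteq> B" "finite B"
  shows "card (trace_on \<S> A) \<le> card (trace_on \<S> B)"
proof -
  have "trace_on \<S> A \<subseteq> (\<lambda>X. X \<inter> A) ` trace_on \<S> B"
  proof
    fix X assume "X \<in> trace_on \<S> A"
    then obtain S where S: "S \<in> \<S>" "X = S \<inter> A" by (auto simp: trace_on_def)
    then have "X = (S \<inter> B) \<inter> A" using assms(1) by auto
    then show "X \<in> (\<lambda>X. X \<inter> A) ` trace_on \<S> B" using S(1) unfolding trace_on_def by blast
  qed
  then show ?thesis
    using finite_trace_on[OF assms(2)] by (meson surj_card_le)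
qed

lemma finite_card_traces:
  "finite {card (trace_on \<S> A) | A. A \<subseteq> V \<and> finite A \<and> card A = t}"
proof (rule finite_subset)
  have "card (trace_on \<S> A) \<le> 2 ^ card A" if "finite A" for A
    using card_mono[OF _ trace_on_subset_Pow, of A \<S>] that by (simp add: card_Pow)
  then show "{card (trace_on \<S> A) | A. A \<subseteq> V \<and> finite A \<and> card A = t} \<subseteq> {..2 ^ t}"
    by blast
qed simp

text \<open>An infinite ground set allows \<open>A\<close> to be padded with fresh points up to size
  \<open>t\<close>, which cannot lower the number of traces.\<close>

lemma card_trace_on_le_shatter_function:
  fixes A :: "'a set"
  assumes "infinite (UNIV :: 'a set)" "finite A" "card A \<le> t"
  shows "card (trace_on \<S> A) \<le> shatter_function UNIV \<S> t"
proof -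
  have "infinite (UNIV - A)" using assms(1,2) by (simp add: Diff_infinite_finite)
  then obtain C where C: "finite C" "card C = t - card A" "C \<subseteq> UNIV - A"
    using infinite_arbitrarily_large by metis
  define B where "B = A \<union> C"
  have B: "finite B" "card B = t" "A \<subseteq> B"
    using C assms card_Un_disjoint[of A C] by (auto simp: B_def)
  have "card (trace_on \<S> A) \<le> card (trace_on \<S> B)"
    using card_trace_on_mono B by blast
  also have "\<dots> \<le> shatter_function UNIV \<S> t"
    unfolding shatter_function_def using B by (intro Max_ge finite_card_traces) auto
  finally show ?thesis .
qed

lemma shatter_function_attained:
  fixes \<S> :: "'a set set"
  assumes "infinite (UNIV :: 'a set)"
  obtains A where "finite A" "card A = t" "shatter_function UNIV \<S> t = card (trace_on \<S> A)"
proof -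
  obtain B :: "'a set" where "finite B" "card B = t"
    using infinite_arbitrarily_large[OF assms] by metis
  then have "{card (trace_on \<S> A) | A. A \<subseteq> UNIV \<and> finite A \<and> card A = t} \<noteq> {}" by blast
  from Max_in[OF finite_card_traces this] obtain A where
    "finite A" "card A = t" "shatter_function UNIV \<S> t = card (trace_on \<S> A)"
    unfolding shatter_function_def by auto
  then show ?thesis by (rule that)
qed

section \<open>Sign systems and local directions of invariance\<close>

text \<open>
  A semilinear set system in sign vector form: \<open>\<Z>\<close> and \<open>\<Y>\<close> are the sign vectors occurring in the
  total set and in the parameter set. The assumption \<open>lift\<close> makes the forms in \<open>Q\<close> carry all
  information on the signs of \<open>H\<close> that depends on the parameter alone.
\<close>
locale sign_system =
  fixes H :: "(('a::euclidean_space \<times> 'b::euclidean_space) \<times> real) set"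
    and Q :: "('b \<times> real) set"
    and \<Z> :: "(('a \<times> 'b) \<times> real \<Rightarrow> real) set"
    and \<Y> :: "('b \<times> real \<Rightarrow> real) set"
  assumes finite_H: "finite H" and finite_Q: "finite Q"
    and lift: "signs Q b = signs Q b' \<Longrightarrow> \<exists>a'. signs H (a', b') = signs H (a, b)"
begin

definition system :: "'a set set" where
  "system = {{a. signs H (a, b) \<in> \<Z>} | b. signs Q b \<in> \<Y>}"

definition flat :: "('b \<times> real \<Rightarrow> real) \<Rightarrow> 'b set" where
  "flat \<kappa> = {w. \<forall>q\<in>Q. \<kappa> q = 0 \<longrightarrow> fst q \<bullet> w = 0}"

text \<open>
  Here \<open>\<kappa>\<close> is the sign vector of a base point \<open>b0\<close>, \<open>\<delta>\<close> that of a parameter cell having \<open>b0\<close> in its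
  closure, and \<open>\<tau>\<close> that of \<open>(a, b0)\<close> for a point \<open>a\<close>. So \<open>flat \<kappa>\<close> is the direction space of the cell of
  \<open>b0\<close>, and \<open>lineality \<kappa> \<delta> \<tau>\<close> consists of those of its directions that leave membership near
  \<open>(a, b0)\<close> within the cell \<open>\<delta>\<close> unchanged.
\<close>
definition lineality ::
    "('b \<times> real \<Rightarrow> real) \<Rightarrow> ('b \<times> real \<Rightarrow> real) \<Rightarrow> (('a \<times> 'b) \<times> real \<Rightarrow> real) \<Rightarrow> 'b set" where
  "lineality \<kappa> \<delta> \<tau> = {w \<in> flat \<kappa>. \<forall>v u x. germ_signs Q \<kappa> u = \<delta> \<longrightarrow>
     (germ_signs H \<tau> (v, u + x *\<^sub>R w) \<in> \<Z> \<longleftrightarrow> germ_signs H \<tau> (v, u) \<in> \<Z>)}"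

lemma subspace_flat: "subspace (flat \<kappa>)"
  by (rule subspaceI) (auto simp: flat_def inner_add_right)

lemma germ_signs_flat:
  assumes "w \<in> flat \<kappa>"
  shows "germ_signs Q \<kappa> (u + w) = germ_signs Q \<kappa> u"
  using assms by (auto simp: germ_signs_def flat_def inner_add_right fun_eq_iff)

text \<open>Moving along a vector of \<open>flat \<kappa>\<close> does not leave the cell
  \<open>\<delta>\<close>, so invariance under \<open>w\<close> and then under \<open>w'\<close> can
  be chained. Scaling is absorbed by the factor \<open>x\<close> in the definition.\<close>

lemma subspace_lineality: "subspace (lineality \<kappa> \<delta> \<tau>)"
proof (rule subspaceI)
  show "0 \<in> lineality \<kappa> \<delta> \<tau>"
    using subspace_0[OF subspace_flat] by (auto simp: lineality_def)
next
  fix w w' assume w: "w \<in> lineality \<kappa> \<delta> \<tau>" "w' \<in> lineality \<kappa> \<delta> \<tau>"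
  have "germ_signs H \<tau> (v, u + x *\<^sub>R (w + w')) \<in> \<Z> \<longleftrightarrow> germ_signs H \<tau> (v, u) \<in> \<Z>"
    if u: "germ_signs Q \<kappa> u = \<delta>" for v u x
  proof -
    have "germ_signs Q \<kappa> (u + x *\<^sub>R w) = \<delta>"
      using u w(1) germ_signs_flat subspace_scale[OF subspace_flat] by (auto simp: lineality_def)
    then have "germ_signs H \<tau> (v, u + x *\<^sub>R w + x *\<^sub>R w') \<in> \<Z> \<longleftrightarrow> germ_signs H \<tau> (v, u + x *\<^sub>R w) \<in> \<Z>"
      using w(2) by (simp add: lineality_def)
    also have "\<dots> \<longleftrightarrow> germ_signs H \<tau> (v, u) \<in> \<Z>"
      using u w(1) by (simp add: lineality_def)
    finally show ?thesis by (simp add: scaleR_add_right add.assoc)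
  qed
  moreover have "w + w' \<in> flat \<kappa>"
    using w subspace_add[OF subspace_flat] by (auto simp: lineality_def)
  ultimately show "w + w' \<in> lineality \<kappa> \<delta> \<tau>" by (auto simp: lineality_def)
next
  fix c w assume w: "w \<in> lineality \<kappa> \<delta> \<tau>"
  then show "c *\<^sub>R w \<in> lineality \<kappa> \<delta> \<tau>"
    using subspace_scale[OF subspace_flat] by (auto simp: lineality_def)
qed

lemma lineality_translate:
  assumes "w \<in> lineality \<kappa> \<delta> \<tau>" "germ_signs Q \<kappa> u = \<delta>"
  shows "germ_signs H \<tau> (v, u + w) \<in> \<Z> \<longleftrightarrow> germ_signs H \<tau> (v, u) \<in> \<Z>"
proof -
  have "germ_signs H \<tau> (v, u + 1 *\<^sub>R w) \<in> \<Z> \<longleftrightarrow> germ_signs H \<tau> (v, u) \<in> \<Z>"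
    using assms unfolding lineality_def by blast
  then show ?thesis by simp
qed

section \<open>Independent points and the lower bound\<close>

text \<open>
  There are \<open>r\<close> points, each with a direction at a common base point that changes membership
  near this point only.
\<close>
definition admits_independent_points :: "nat \<Rightarrow> bool" where
  "admits_independent_points r \<longleftrightarrow> (\<exists>b0 \<delta> u0 A w. \<delta> \<in> \<Y> \<and> germ_signs Q (signs Q b0) u0 = \<delta> \<and>
     finite A \<and> card A = r \<and> (\<forall>a\<in>A. w a \<in> flat (signs Q b0) \<and>
       w a \<notin> lineality (signs Q b0) \<delta> (signs H (a, b0)) \<and>
       (\<forall>a'\<in>A - {a}. w a \<in> lineality (signs Q b0) \<delta> (signs H (a', b0)))))"

text \<open>A small shift of \<open>b0\<close> along \<open>w\<close> stays in its cell, so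
  \<open>lift\<close> yields a point \<open>a'\<close> over it with the sign vector of
  \<open>(a, b0)\<close>. Forms vanishing at \<open>(a, b0)\<close> vanish at both points, hence on
  their difference; rescaling gives \<open>\<rho>\<close>.\<close>

lemma flat_shift_compensated:
  assumes "w \<in> flat (signs Q b0)"
  shows "\<exists>\<rho>. \<forall>h\<in>H. signs H (a, b0) h = 0 \<longrightarrow> fst h \<bullet> (\<rho>, w) = 0"
proof -
  have "\<forall>\<^sub>F \<epsilon> in at_right 0. 0 < \<epsilon> \<and> signs Q (b0 + \<epsilon> *\<^sub>R w) = germ_signs Q (signs Q b0) w"
    by (intro eventually_conj eventually_at_right_less eventually_signs_ray finite_Q)
  then obtain \<epsilon> where \<epsilon>: "\<epsilon> > 0" "signs Q (b0 + \<epsilon> *\<^sub>R w) = germ_signs Q (signs Q b0) w"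
    using eventually_happens'[OF trivial_limit_at_right_real] by blast
  have "germ_signs Q (signs Q b0) w = signs Q b0"
    using assms by (auto simp: germ_signs_def flat_def fun_eq_iff signs_def)
  with \<epsilon> obtain a' where a': "signs H (a', b0 + \<epsilon> *\<^sub>R w) = signs H (a, b0)"
    using lift[of b0 "b0 + \<epsilon> *\<^sub>R w" a] by auto
  have "fst h \<bullet> ((a' - a) /\<^sub>R \<epsilon>, w) = 0" if h: "h \<in> H" "signs H (a, b0) h = 0" for h
  proof -
    have "fst h \<bullet> (a, b0) = snd h" using h by (simp add: signs_eq_0_iff)
    moreover have "fst h \<bullet> (a', b0 + \<epsilon> *\<^sub>R w) = snd h"
      using h a' signs_eq_0_iff by metis
    moreover have "((a' - a) /\<^sub>R \<epsilon>, w) = ((a', b0 + \<epsilon> *\<^sub>R w) - (a, b0)) /\<^sub>R \<epsilon>"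
      using \<epsilon>(1) by simp
    ultimately show ?thesis by (simp only: inner_scaleR_right inner_diff_right) simp
  qed
  then show ?thesis by blast
qed

text \<open>Short steps along \<open>u\<close> and \<open>u'\<close> lead from \<open>b0\<close>
  into the same parameter cell. There \<open>lift\<close> transports the point
  \<open>a + \<epsilon> *\<^sub>R v\<close>, and rescaling the displacement from \<open>a\<close>
  gives \<open>v'\<close>.\<close>

lemma germ_signs_realized_in_cell:
  assumes "germ_signs Q (signs Q b0) u = germ_signs Q (signs Q b0) u'"
  shows "\<exists>v'. germ_signs H (signs H (a, b0)) (v', u') = germ_signs H (signs H (a, b0)) (v, u)"
proof -
  have "\<forall>\<^sub>F \<epsilon> in at_right 0. 0 < \<epsilon> \<and> signs Q (b0 + \<epsilon> *\<^sub>R u) = germ_signs Q (signs Q b0) u \<and>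
      signs Q (b0 + \<epsilon> *\<^sub>R u') = germ_signs Q (signs Q b0) u' \<and>
      signs H ((a, b0) + \<epsilon> *\<^sub>R (v, u)) = germ_signs H (signs H (a, b0)) (v, u)"
    by (intro eventually_conj eventually_at_right_less eventually_signs_ray finite_H finite_Q)
  then obtain \<epsilon> where \<epsilon>: "0 < \<epsilon>" "signs Q (b0 + \<epsilon> *\<^sub>R u) = germ_signs Q (signs Q b0) u"
      "signs Q (b0 + \<epsilon> *\<^sub>R u') = germ_signs Q (signs Q b0) u'"
      "signs H ((a, b0) + \<epsilon> *\<^sub>R (v, u)) = germ_signs H (signs H (a, b0)) (v, u)"
    using eventually_happens'[OF trivial_limit_at_right_real] by blast
  obtain a' where a': "signs H (a', b0 + \<epsilon> *\<^sub>R u') = signs H (a + \<epsilon> *\<^sub>R v, b0 + \<epsilon> *\<^sub>R u)"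
    using lift[of "b0 + \<epsilon> *\<^sub>R u" "b0 + \<epsilon> *\<^sub>R u'"] \<epsilon> assms by metis
  let ?v = "(a' - a) /\<^sub>R \<epsilon>"
  have "germ_signs H (signs H (a, b0)) (?v, u') h = germ_signs H (signs H (a, b0)) (v, u) h" for h
  proof (cases "h \<in> H \<and> signs H (a, b0) h = 0")
    case True
    have "sgn (fst h \<bullet> (?v, u')) = sgn (fst h \<bullet> (\<epsilon> *\<^sub>R (?v, u')))"
      using \<epsilon>(1) by (simp only: inner_scaleR_right sgn_mult) simp
    also have "\<epsilon> *\<^sub>R (?v, u') = (a', b0 + \<epsilon> *\<^sub>R u') - (a, b0)"
      using \<epsilon>(1) by simp
    also have "sgn (fst h \<bullet> \<dots>) = signs H (a', b0 + \<epsilon> *\<^sub>R u') h"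
    proof -
      have "fst h \<bullet> (a, b0) = snd h" using True by (simp add: signs_eq_0_iff)
      then show ?thesis using True by (simp add: inner_diff_right signs_def del: diff_Pair)
    qed
    also have "\<dots> = germ_signs H (signs H (a, b0)) (v, u) h"
      using a' \<epsilon>(4) by simp
    finally show ?thesis using True by (simp add: germ_signs_def)
  qed (auto simp: germ_signs_def)
  then show ?thesis by (intro exI[of _ ?v]) (simp add: fun_eq_iff)
qed

text \<open>Without a jump of membership next to some point, membership would be locally constant,
  hence constant, on every line in direction \<open>w\<close>, and \<open>w\<close> would lie in the
  lineality space.\<close>

lemma crossing:
  assumes w: "w \<in> flat (signs Q b0)" "w \<notin> lineality (signs Q b0) \<delta> (signs H (a, b0))"
    and u0: "germ_signs Q (signs Q b0) u0 = \<delta>"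
  shows "\<exists>v c. \<forall>\<^sub>F y in at_right 0. germ_signs H (signs H (a, b0)) (v, u0 + y *\<^sub>R c *\<^sub>R w) \<in> \<Z> \<longleftrightarrow>
           germ_signs H (signs H (a, b0)) (v, u0) \<notin> \<Z>"
proof -
  define \<tau> where "\<tau> = signs H (a, b0)"
  have "\<exists>v u c. germ_signs Q (signs Q b0) u = \<delta> \<and>
      (germ_signs H (germ_signs H \<tau> (v, u)) (0, c *\<^sub>R w) \<in> \<Z> \<longleftrightarrow> germ_signs H \<tau> (v, u) \<notin> \<Z>)"
  proof (rule ccontr)
    assume "\<not> ?thesis"
    then have const: "germ_signs H (germ_signs H \<tau> (v, u)) (0, c *\<^sub>R w) \<in> \<Z> \<longleftrightarrow> germ_signs H \<tau> (v, u) \<in> \<Z>"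
      if "germ_signs Q (signs Q b0) u = \<delta>" for v u c using that by blast
    have "germ_signs H \<tau> (v, u + x *\<^sub>R w) \<in> \<Z> \<longleftrightarrow> germ_signs H \<tau> (v, u) \<in> \<Z>"
      if u: "germ_signs Q (signs Q b0) u = \<delta>" for v u x
    proof -
      define P where "P = (\<lambda>y. germ_signs H \<tau> (v, u + y *\<^sub>R w) \<in> \<Z>)"
      have loc: "\<forall>\<^sub>F y in nhds y0. P y = P y0" for y0
      proof -
        define \<sigma> where "\<sigma> = germ_signs H \<tau> (v, u + y0 *\<^sub>R w)"
        have \<sigma>: "germ_signs H \<sigma> (0, c *\<^sub>R w) \<in> \<Z> \<longleftrightarrow> \<sigma> \<in> \<Z>" for c
          unfolding \<sigma>_def using u w(1) germ_signs_flat subspace_scale[OF subspace_flat]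
          by (intro const) auto
        have "filterlim (\<lambda>y. (v, u + y *\<^sub>R w)) (nhds (v, u + y0 *\<^sub>R w)) (nhds y0)"
          by (intro tendsto_intros filterlim_ident)
        from this[unfolded filterlim_iff, rule_format, OF eventually_germ_signs[OF finite_H, of \<tau>]]
        have "\<forall>\<^sub>F y in nhds y0. germ_signs H \<tau> (v, u + y *\<^sub>R w) = germ_signs H \<sigma> (0, (y - y0) *\<^sub>R w)"
          by (simp add: \<sigma>_def algebra_simps)
        then show ?thesis
          by eventually_elim (simp add: P_def \<sigma> flip: \<sigma>_def)
      qed
      \<comment> \<open>Local constancy makes both \<open>P\<close> and its negation open, so by
        connectedness of the line one of them is empty.\<close>
      have "open {y. P y = d}" for d
      proof (subst open_subopen, intro ballI)
        fix y0 assume y0: "y0 \<in> {y. P y = d}"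
        obtain S where S: "open S" "y0 \<in> S" "\<forall>y\<in>S. P y = P y0"
          using loc[of y0] unfolding eventually_nhds by (elim exE conjE) (rule that)
        have "S \<subseteq> {y. P y = d}"
        proof
          fix y assume "y \<in> S"
          with S(3) have "P y = P y0" by (rule bspec)
          then show "y \<in> {y. P y = d}" using y0 by simp
        qed
        then show "\<exists>S. open S \<and> y0 \<in> S \<and> S \<subseteq> {y. P y = d}" using S by blast
      qed
      from this[of True] this[of False] have "open {y. P y}" "open {y. \<not> P y}" by simp_all
      moreover have "- {y. P y} = {y. \<not> P y}" by auto
      ultimately have "{y. P y} = {} \<or> {y. P y} = UNIV"
        using clopen[of "{y. P y}"] by (simp add: closed_def)
      then have "P x = P 0" by blast
      then show ?thesis by (simp add: P_def)
    qed
    with w show False by (auto simp: lineality_def \<tau>_def)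
  qed
  then obtain v u c where u: "germ_signs Q (signs Q b0) u = \<delta>"
    and vuc: "germ_signs H (germ_signs H \<tau> (v, u)) (0, c *\<^sub>R w) \<in> \<Z> \<longleftrightarrow> germ_signs H \<tau> (v, u) \<notin> \<Z>"
    by blast
  \<comment> \<open>The jump was found at some \<open>u\<close> of the cell; it is carried over to
    the prescribed \<open>u0\<close>.\<close>
  obtain v' where v': "germ_signs H \<tau> (v', u0) = germ_signs H \<tau> (v, u)"
    using germ_signs_realized_in_cell[of b0 u u0 a v] u u0 unfolding \<tau>_def by metis
  have "\<forall>\<^sub>F y in at_right 0. germ_signs H \<tau> ((v', u0) + y *\<^sub>R (0, c *\<^sub>R w)) = germ_signs H (germ_signs H \<tau> (v', u0)) (0, c *\<^sub>R w)"
    by (rule eventually_germ_signs_ray[OF finite_H])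
  then have "\<forall>\<^sub>F y in at_right 0. germ_signs H \<tau> (v', u0 + y *\<^sub>R c *\<^sub>R w) \<in> \<Z> \<longleftrightarrow> germ_signs H \<tau> (v', u0) \<notin> \<Z>"
    by eventually_elim (use vuc v' in simp)
  then show ?thesis unfolding \<tau>_def by blast
qed

text \<open>The lineality space at \<open>a\<close> contains the span of the directions of all other
  points but not \<open>w a\<close>, so the directions are linearly independent.\<close>

lemma admits_independent_points_le_dim:
  assumes "admits_independent_points r"
  shows "r \<le> DIM('b)"
proof -
  obtain b0 \<delta> A w where A: "finite A" "card A = r"
    and w: "\<And>a. a \<in> A \<Longrightarrow> w a \<notin> lineality (signs Q b0) \<delta> (signs H (a, b0))"
    "\<And>a a'. a \<in> A \<Longrightarrow> a' \<in> A - {a} \<Longrightarrow> w a \<in> lineality (signs Q b0) \<delta> (signs H (a', b0))"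
    using assms unfolding admits_independent_points_def by metis
  have "independent (w ` F) \<and> card (w ` F) = card F" if "finite F" "F \<subseteq> A" for F
    using that
  proof (induction F rule: finite_induct)
    case empty
    then show ?case by (simp add: independent_empty)
  next
    case (insert a F)
    have "w ` F \<subseteq> lineality (signs Q b0) \<delta> (signs H (a, b0))"
      using insert.prems insert.hyps w(2) by blast
    then have "span (w ` F) \<subseteq> lineality (signs Q b0) \<delta> (signs H (a, b0))"
      by (intro span_minimal subspace_lineality)
    then have "w a \<notin> span (w ` F)" using w(1) insert.prems by blast
    then show ?case
      using insert span_base[of "w a" "w ` F"] by (auto simp: independent_insert card_insert_if)
  qed
  then have "independent (w ` A)" "card (w ` A) = r" using A by auto
  then show ?thesis using independent_bound by metis
qed

text \<open>Parameters are indexed by functions \<open>l\<close> on \<open>A\<close> with values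
  below \<open>k\<close>, and each \<open>a\<close> gets \<open>k\<close> copies. At copy
  \<open>i\<close> of \<open>a\<close>, only the offset \<open>l a - i\<close> matters: a zero
  offset and a positive one lie on different sides of a crossing.\<close>

lemma card_traces_lower_bound:
  assumes "admits_independent_points r"
  shows "\<exists>A. finite A \<and> card A \<le> r * k \<and> k ^ r \<le> card (trace_on system A)"
proof -
  obtain b0 \<delta> u0 A w where \<delta>: "\<delta> \<in> \<Y>" and u0: "germ_signs Q (signs Q b0) u0 = \<delta>"
    and A: "finite A" "card A = r"
    and w: "\<And>a. a \<in> A \<Longrightarrow> w a \<in> flat (signs Q b0)"
      "\<And>a. a \<in> A \<Longrightarrow> w a \<notin> lineality (signs Q b0) \<delta> (signs H (a, b0))"
      "\<And>a a'. a \<in> A \<Longrightarrow> a' \<in> A - {a} \<Longrightarrow> w a \<in> lineality (signs Q b0) \<delta> (signs H (a', b0))"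
    using assms unfolding admits_independent_points_def by metis
  define \<kappa> where "\<kappa> = signs Q b0"
  define \<tau> where "\<tau> = (\<lambda>a. signs H (a, b0))"
  obtain v c where vc: "\<And>a. a \<in> A \<Longrightarrow> \<forall>\<^sub>F y in at_right 0.
      germ_signs H (\<tau> a) (v a, u0 + y *\<^sub>R c a *\<^sub>R w a) \<in> \<Z> \<longleftrightarrow> germ_signs H (\<tau> a) (v a, u0) \<notin> \<Z>"
    using crossing[OF w(1,2) u0] unfolding \<tau>_def by metis
  define w' where "w' = (\<lambda>a. c a *\<^sub>R w a)"
  have w'_flat: "w' a \<in> flat \<kappa>" if "a \<in> A" for a
    using w(1)[OF that] subspace_scale[OF subspace_flat] by (simp add: w'_def \<kappa>_def)
  have w'_lin: "w' a' \<in> lineality \<kappa> \<delta> (\<tau> a)" if "a \<in> A" "a' \<in> A - {a}" for a a'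
    using w(3)[of a' a] that subspace_scale[OF subspace_lineality] by (auto simp: w'_def \<kappa>_def \<tau>_def)
  obtain \<rho> where \<rho>: "\<And>a h. a \<in> A \<Longrightarrow> h \<in> H \<Longrightarrow> \<tau> a h = 0 \<Longrightarrow> fst h \<bullet> (\<rho> a, w' a) = 0"
  proof -
    have "\<forall>a\<in>A. \<exists>\<rho>. \<forall>h\<in>H. \<tau> a h = 0 \<longrightarrow> fst h \<bullet> (\<rho>, w' a) = 0"
      using flat_shift_compensated w'_flat unfolding \<kappa>_def \<tau>_def by blast
    from bchoice[OF this] show ?thesis using that by blast
  qed
  have "\<forall>\<^sub>F y in at_right 0. \<forall>a\<in>A.
      germ_signs H (\<tau> a) (v a, u0 + y *\<^sub>R w' a) \<in> \<Z> \<longleftrightarrow> germ_signs H (\<tau> a) (v a, u0) \<notin> \<Z>"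
    using vc A(1) unfolding w'_def by (intro eventually_ball_finite) blast+
  then obtain y0 where "y0 > 0" and cross: "\<And>y a. 0 < y \<Longrightarrow> y < y0 \<Longrightarrow> a \<in> A \<Longrightarrow>
      germ_signs H (\<tau> a) (v a, u0 + y *\<^sub>R w' a) \<in> \<Z> \<longleftrightarrow> germ_signs H (\<tau> a) (v a, u0) \<notin> \<Z>"
    unfolding eventually_at_right_field by metis
  \<comment> \<open>This makes every offset \<open>(l a - i) * \<eta>\<close> smaller than
    \<open>y0\<close>, so all positive offsets are in the range of the crossing.\<close>
  define \<eta> where "\<eta> = y0 / (real k + 1)"
  have \<eta>: "\<eta> > 0" using \<open>y0 > 0\<close> by (simp add: \<eta>_def)
  have \<eta>k: "x * \<eta> < y0" if "x < real k" for x
  proof -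
    have "x * \<eta> < (real k + 1) * \<eta>" using that \<eta> by simp
    then show ?thesis by (simp add: \<eta>_def add_eq_0_iff)
  qed
  define L where "L = PiE A (\<lambda>_. {..<k})"
  define u where "u = (\<lambda>l::'a \<Rightarrow> nat. u0 + (\<Sum>a\<in>A. (real (l a) * \<eta>) *\<^sub>R w' a))"
  define p where "p = (\<lambda>a i. v a + (real i * \<eta>) *\<^sub>R \<rho> a)"
  have u_cell: "germ_signs Q \<kappa> (u l) = \<delta>" for l
  proof -
    have "(\<Sum>a\<in>A. (real (l a) * \<eta>) *\<^sub>R w' a) \<in> flat \<kappa>"
      using w'_flat by (intro subspace_sum[OF subspace_flat] subspace_scale[OF subspace_flat])
    then show ?thesis using germ_signs_flat u0 by (simp add: u_def \<kappa>_def)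
  qed
  \<comment> \<open>Shifts belonging to other points lie in the lineality space at \<open>a\<close>;
    the shift by \<open>i\<close> steps along \<open>w' a\<close> is undone by the displacement
    along \<open>\<rho> a\<close>.\<close>
  have key: "germ_signs H (\<tau> a) (p a i, u l) \<in> \<Z> \<longleftrightarrow>
      germ_signs H (\<tau> a) (v a, u0 + ((real (l a) - real i) * \<eta>) *\<^sub>R w' a) \<in> \<Z>" if a: "a \<in> A" for a i l
  proof -
    define u1 where "u1 = u0 + (real (l a) * \<eta>) *\<^sub>R w' a"
    define w1 where "w1 = (\<Sum>a'\<in>A - {a}. (real (l a') * \<eta>) *\<^sub>R w' a')"
    have "u l = u1 + w1"
      using a A(1) by (simp add: u_def u1_def w1_def sum.remove add.assoc)
    moreover have "w1 \<in> lineality \<kappa> \<delta> (\<tau> a)"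
      unfolding w1_def using w'_lin[OF a]
      by (intro subspace_sum[OF subspace_lineality] subspace_scale[OF subspace_lineality])
    moreover have "germ_signs Q \<kappa> u1 = \<delta>"
      using germ_signs_flat[OF subspace_scale[OF subspace_flat w'_flat[OF a]]] u0
      by (simp add: u1_def \<kappa>_def)
    ultimately have "germ_signs H (\<tau> a) (p a i, u l) \<in> \<Z> \<longleftrightarrow> germ_signs H (\<tau> a) (p a i, u1) \<in> \<Z>"
      by (simp add: lineality_translate)
    also have "germ_signs H (\<tau> a) (p a i, u1) =
        germ_signs H (\<tau> a) (v a, u0 + ((real (l a) - real i) * \<eta>) *\<^sub>R w' a)"
    proof -
      have shift: "(p a i, u1) =
          (v a, u0 + ((real (l a) - real i) * \<eta>) *\<^sub>R w' a) + (real i * \<eta>) *\<^sub>R (\<rho> a, w' a)"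
        by (simp add: p_def u1_def algebra_simps)
      have "fst h \<bullet> (z + (real i * \<eta>) *\<^sub>R (\<rho> a, w' a)) = fst h \<bullet> z" if "h \<in> H" "\<tau> a h = 0" for h z
        unfolding inner_add_right inner_scaleR_right \<rho>[OF a that] by simp
      then show ?thesis unfolding shift germ_signs_def by (intro ext) (simp del: add_Pair scaleR_Pair)
    qed
    finally show ?thesis .
  qed
  have finL: "finite L" unfolding L_def using A(1) by (intro finite_PiE) auto
  \<comment> \<open>One \<open>\<epsilon>\<close> realises the finitely many germs by actual points
    and parameters.\<close>
  have "\<forall>\<^sub>F \<epsilon> in at_right 0. \<forall>l\<in>L. signs Q (b0 + \<epsilon> *\<^sub>R u l) = germ_signs Q (signs Q b0) (u l) \<and>
      (\<forall>a\<in>A. \<forall>i\<in>{..<k}. signs H ((a, b0) + \<epsilon> *\<^sub>R (p a i, u l)) = germ_signs H (signs H (a, b0)) (p a i, u l))"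
    using finL A(1) finite_H finite_Q
    by (intro eventually_ball_finite ballI eventually_conj eventually_signs_ray) auto
  from eventually_happens'[OF trivial_limit_at_right_real this]
  obtain \<epsilon> where \<epsilon>: "\<And>l. l \<in> L \<Longrightarrow> signs Q (b0 + \<epsilon> *\<^sub>R u l) = germ_signs Q \<kappa> (u l)"
      "\<And>l a i. l \<in> L \<Longrightarrow> a \<in> A \<Longrightarrow> i < k \<Longrightarrow>
         signs H ((a, b0) + \<epsilon> *\<^sub>R (p a i, u l)) = germ_signs H (\<tau> a) (p a i, u l)"
    unfolding \<kappa>_def \<tau>_def by blast
  define pts where "pts = (\<lambda>(a, i). a + \<epsilon> *\<^sub>R p a i) ` (A \<times> {..<k})"
  define tr where "tr = (\<lambda>l. {x. signs H (x, b0 + \<epsilon> *\<^sub>R u l) \<in> \<Z>} \<inter> pts)"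
  have fin_pts: "finite pts" using A(1) by (simp add: pts_def)
  have tr_ne: "tr l \<noteq> tr l'" if l: "l \<in> L" "l' \<in> L" "a \<in> A" "l a < l' a" for l l' a
  proof -
    have lk: "l a < k" "l' a < k" using l by (auto simp: L_def)
    \<comment> \<open>This copy has offset 0 for \<open>l\<close> and a positive offset for
      \<open>l'\<close>, so its membership differs.\<close>
    let ?x = "a + \<epsilon> *\<^sub>R p a (l a)"
    have pt: "?x \<in> pts" using l(3) lk by (auto simp: pts_def)
    have mem: "?x \<in> tr l'' \<longleftrightarrow> germ_signs H (\<tau> a) (v a, u0 + ((real (l'' a) - real (l a)) * \<eta>) *\<^sub>R w' a) \<in> \<Z>"
      if "l'' \<in> L" for l''
      using \<epsilon>(2)[OF that l(3) lk(1)] key[OF l(3), of "l a" l''] pt by (simp add: tr_def)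
    have "?x \<in> tr l' \<longleftrightarrow> germ_signs H (\<tau> a) (v a, u0) \<notin> \<Z>"
      unfolding mem[OF l(2)] using l(3,4) \<eta> \<eta>k[of "real (l' a) - real (l a)"] lk
      by (intro cross) auto
    moreover have "?x \<in> tr l \<longleftrightarrow> germ_signs H (\<tau> a) (v a, u0) \<in> \<Z>"
      using mem[OF l(1)] by simp
    ultimately show ?thesis by blast
  qed
  have "inj_on tr L"
  proof (rule inj_onI, rule ccontr)
    fix l l' assume l: "l \<in> L" "l' \<in> L" "tr l = tr l'" "l \<noteq> l'"
    then obtain a where "a \<in> A" "l a \<noteq> l' a"
      unfolding L_def by (metis PiE_ext)
    then show False using tr_ne[of l l' a] tr_ne[of l' l a] l by (metis linorder_neqE_nat)
  qed
  moreover have "tr ` L \<subseteq> trace_on system pts"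
  proof (rule image_subsetI)
    fix l assume "l \<in> L"
    then have "signs Q (b0 + \<epsilon> *\<^sub>R u l) \<in> \<Y>" using \<epsilon>(1) u_cell \<delta> by simp
    then have "{x. signs H (x, b0 + \<epsilon> *\<^sub>R u l) \<in> \<Z>} \<in> system" unfolding system_def by blast
    then show "tr l \<in> trace_on system pts" unfolding tr_def trace_on_def by blast
  qed
  ultimately have "card L \<le> card (trace_on system pts)"
    using finite_trace_on[OF fin_pts] by (rule card_inj_on_le)
  moreover have "card L = k ^ r"
    using A by (simp add: L_def card_PiE)
  moreover have "card pts \<le> r * k"
    using card_image_le[of "A \<times> {..<k}" "\<lambda>(a, i). a + \<epsilon> *\<^sub>R p a i"] A by (simp add: pts_def)
  ultimately show ?thesis using fin_pts by auto
qed

section \<open>Base points of minimal norm and the upper bound\<close>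

text \<open>Intersecting with the flat explicitly gives the flat, not the whole space, when
  \<open>A\<close> is empty.\<close>

definition joint_lineality :: "'b \<Rightarrow> ('b \<times> real \<Rightarrow> real) \<Rightarrow> 'a set \<Rightarrow> 'b set" where
  "joint_lineality b0 \<delta> A =
     flat (signs Q b0) \<inter> (\<Inter>a\<in>A. lineality (signs Q b0) \<delta> (signs H (a, b0)))"

lemma subspace_joint_lineality: "subspace (joint_lineality b0 \<delta> A)"
  unfolding joint_lineality_def
  by (auto intro!: subspace_inter subspace_flat subspace_Inter subspace_lineality)

lemma joint_lineality_antimono: "A \<subseteq> B \<Longrightarrow> joint_lineality b0 \<delta> B \<subseteq> joint_lineality b0 \<delta> A"
  unfolding joint_lineality_def by (intro Int_mono INT_anti_mono) auto

lemma eventually_cone: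
  assumes "finite A"
  shows "\<forall>\<^sub>F b in nhds b0. signs Q b = germ_signs Q (signs Q b0) (b - b0) \<and>
           (\<forall>a\<in>A. signs H (a, b) = germ_signs H (signs H (a, b0)) (0, b - b0))"
proof (intro eventually_conj eventually_signs[OF finite_Q] eventually_ball_finite[OF assms] ballI)
  fix a :: 'a
  have "filterlim (\<lambda>b. (a, b)) (nhds (a, b0)) (nhds b0)"
    by (intro tendsto_intros filterlim_ident)
  from this[unfolded filterlim_iff, rule_format, OF eventually_signs[OF finite_H]]
  show "\<forall>\<^sub>F b in nhds b0. signs H (a, b) = germ_signs H (signs H (a, b0)) (0, b - b0)"
    by simp
qed

text \<open>
  The base point \<open>b0\<close> is a point of minimal norm in the closure of the set of parameters in the cell
  \<open>\<delta>\<close> that have trace \<open>X\<close>; minimality makes it orthogonal to the directions along which that set is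
  locally invariant.
\<close>
lemma trace_base_point:
  assumes A: "finite A" and X: "X \<in> trace_on system A"
  obtains b0 \<delta> u where "\<delta> \<in> \<Y>" "germ_signs Q (signs Q b0) u = \<delta>" "\<delta> \<in> sign_vectors Q"
    "X = {a\<in>A. germ_signs H (signs H (a, b0)) (0, u) \<in> \<Z>}"
    "\<And>w. w \<in> joint_lineality b0 \<delta> A \<Longrightarrow> b0 \<bullet> w = 0"
proof -
  obtain b1 where b1: "signs Q b1 \<in> \<Y>" "X = {a\<in>A. signs H (a, b1) \<in> \<Z>}"
    using X unfolding trace_on_def system_def by blast
  define \<delta> where "\<delta> = signs Q b1"
  define B where "B = {b. signs Q b = \<delta> \<and> {a\<in>A. signs H (a, b) \<in> \<Z>} = X}"
  have "b1 \<in> B" using b1 by (simp add: B_def \<delta>_def)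
  then obtain b0 where b0: "b0 \<in> closure B" and min: "\<And>b. b \<in> closure B \<Longrightarrow> norm b0 \<le> norm b"
    using distance_attains_inf[of "closure B" 0] closure_subset by (metis closed_closure dist_0_norm empty_iff subsetD)
  obtain d where d: "d > 0" and cone: "\<And>b. dist b b0 < d \<Longrightarrow> signs Q b = germ_signs Q (signs Q b0) (b - b0)"
      "\<And>b a. dist b b0 < d \<Longrightarrow> a \<in> A \<Longrightarrow> signs H (a, b) = germ_signs H (signs H (a, b0)) (0, b - b0)"
    using eventually_cone[OF A, of b0] unfolding eventually_nhds_metric by blast
  obtain b2 where b2: "b2 \<in> B" "dist b2 b0 < d"
    using b0 d unfolding closure_approachable by blast
  show ?thesis
  proof (rule that[of \<delta> b0 "b2 - b0"])
    show "\<delta> \<in> \<Y>" "\<delta> \<in> sign_vectors Q" using b1 signs_in_sign_vectors by (auto simp: \<delta>_def)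
    show "germ_signs Q (signs Q b0) (b2 - b0) = \<delta>"
      using b2 cone(1) by (simp add: B_def)
    show "X = {a\<in>A. germ_signs H (signs H (a, b0)) (0, b2 - b0) \<in> \<Z>}"
      using b2 cone(2) by (auto simp: B_def)
  next
    fix w assume w: "w \<in> joint_lineality b0 \<delta> A"
    \<comment> \<open>Near \<open>b0\<close> the cell and the trace are invariant under
      \<open>w'\<close>, so approximants of \<open>b0\<close> in \<open>B\<close> translate to
      approximants of \<open>b0 + w'\<close> in \<open>B\<close>.\<close>
    have near: "b0 + w' \<in> closure B" if w': "w' \<in> joint_lineality b0 \<delta> A" "norm w' < d / 2" for w'
      unfolding closure_approachable
    proof (intro allI impI)
      fix e :: real assume "e > 0"
      \<comment> \<open>The bound \<open>d / 2\<close> keeps both \<open>b\<close> and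
        \<open>b + w'\<close> within distance \<open>d\<close> of \<open>b0\<close>.\<close>
      then have "min e (d / 2) > 0" using d by simp
      then obtain b where b: "b \<in> B" "dist b b0 < min e (d / 2)"
        using b0 unfolding closure_approachable by blast
      have "norm (b + w' - b0) \<le> norm (b - b0) + norm w'"
        using norm_triangle_ineq[of "b - b0" w'] by (simp add: algebra_simps)
      then have bw: "dist (b + w') b0 < d"
        using b(2) w'(2) by (simp add: dist_norm)
      have bd: "dist b b0 < d" using b(2) d by simp
      have shift: "b + w' - b0 = b - b0 + w'" by simp
      have cell: "germ_signs Q (signs Q b0) (b - b0) = \<delta>"
        using cone(1)[OF bd] b(1) by (simp add: B_def)
      have "signs Q (b + w') = \<delta>"
        unfolding cone(1)[OF bw] shift using w'(1) cell
        by (simp add: germ_signs_flat joint_lineality_def)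
      moreover have "signs H (a, b + w') \<in> \<Z> \<longleftrightarrow> signs H (a, b) \<in> \<Z>" if "a \<in> A" for a
        unfolding cone(2)[OF bw that] cone(2)[OF bd that] shift
        using w'(1) that by (intro lineality_translate[OF _ cell]) (auto simp: joint_lineality_def)
      ultimately have "b + w' \<in> B" using b(1) by (auto simp: B_def)
      moreover have "dist (b + w') (b0 + w') < e" using b(2) by simp
      ultimately show "\<exists>y\<in>B. dist y (b0 + w') < e" by blast
    qed
    \<comment> \<open>The squared norm along the line through \<open>b0\<close> in direction
      \<open>w\<close> has a local minimum at 0, so its derivative
      \<open>2 * (b0 \<bullet> w)\<close> vanishes there.\<close>
    define f where "f = (\<lambda>t. b0 \<bullet> b0 + 2 * t * (b0 \<bullet> w) + t\<^sup>2 * (w \<bullet> w))"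
    have f: "f t = (norm (b0 + t *\<^sub>R w))\<^sup>2" for t
      by (simp add: f_def power2_norm_eq_inner inner_add_left inner_add_right inner_commute power2_eq_square[of t] algebra_simps)
    have "DERIV f 0 :> 2 * (b0 \<bullet> w)"
      unfolding f_def by (auto intro!: derivative_eq_intros)
    moreover have "d / (2 * (norm w + 1)) > 0" using d by (simp add: add_nonneg_pos)
    moreover have "\<forall>t. \<bar>0 - t\<bar> < d / (2 * (norm w + 1)) \<longrightarrow> f 0 \<le> f t"
    proof (intro allI impI)
      fix t assume t: "\<bar>0 - t\<bar> < d / (2 * (norm w + 1))"
      have "norm (t *\<^sub>R w) \<le> \<bar>t\<bar> * (norm w + 1)" by (simp add: mult_left_mono)
      also have "\<dots> < d / 2"
        using t by (simp add: pos_less_divide_eq add_nonneg_pos mult.commute mult.left_commute)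
      finally have "b0 + t *\<^sub>R w \<in> closure B"
        using w by (intro near subspace_scale[OF subspace_joint_lineality])
      then show "f 0 \<le> f t" unfolding f using min by (intro power_mono) auto
    qed
    ultimately have "2 * (b0 \<bullet> w) = 0" by (rule DERIV_local_min)
    then show "b0 \<bullet> w = 0" by simp
  qed
qed

text \<open>In a smallest subset with the same joint lineality space, dropping any point enlarges
  the space. A vector gained in this way for each point shows that the subset is a set of
  independent points, so it has at most \<open>s\<close> elements.\<close>

lemma joint_lineality_attained:
  assumes A: "finite A" "A \<noteq> {}" and \<delta>: "\<delta> \<in> \<Y>" "germ_signs Q (signs Q b0) u = \<delta>"
    and s: "\<And>r. admits_independent_points r \<Longrightarrow> r \<le> s"
  shows "\<exists>xs. length xs = s \<and> set xs \<subseteq> A \<and> joint_lineality b0 \<delta> (set xs) = joint_lineality b0 \<delta> A"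
proof -
  let ?W = "joint_lineality b0 \<delta>"
  obtain A0 where A0: "A0 \<subseteq> A" "?W A0 = ?W A"
    and min: "\<And>A1. A1 \<subseteq> A \<Longrightarrow> ?W A1 = ?W A \<Longrightarrow> card A0 \<le> card A1"
  proof -
    define P where "P = (\<lambda>A0. A0 \<subseteq> A \<and> ?W A0 = ?W A)"
    have "P A" by (simp add: P_def)
    then obtain A0 where A0: "P A0" "\<forall>A1. P A1 \<longrightarrow> card A0 \<le> card A1"
      using ex_has_least_nat[of P A card] by blast
    show ?thesis by (rule that[of A0]) (use A0 in \<open>simp_all add: P_def\<close>)
  qed
  have fin: "finite A0" using A0(1) A(1) by (rule finite_subset)
  have "\<exists>w. w \<in> ?W (A0 - {a}) \<and> w \<notin> ?W A0" if a: "a \<in> A0" for a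
  proof (rule ccontr)
    assume "\<not> ?thesis"
    then have "?W (A0 - {a}) \<subseteq> ?W A0" by blast
    then have "?W (A0 - {a}) = ?W A"
      using A0(2) joint_lineality_antimono[of "A0 - {a}" A0 b0 \<delta>] by blast
    then have "card A0 \<le> card (A0 - {a})" using A0(1) by (intro min) auto
    then show False using a fin by (metis card_Diff1_less not_le)
  qed
  then obtain w where w: "\<And>a. a \<in> A0 \<Longrightarrow> w a \<in> ?W (A0 - {a}) \<and> w a \<notin> ?W A0" by metis
  have "admits_independent_points (card A0)"
    unfolding admits_independent_points_def
  proof (rule exI[of _ b0], rule exI[of _ \<delta>], rule exI[of _ u], rule exI[of _ A0], rule exI[of _ w],
      intro conjI ballI)
    fix a assume a: "a \<in> A0"
    show "w a \<in> flat (signs Q b0)" using w[OF a] by (simp add: joint_lineality_def)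
    show "w a \<in> lineality (signs Q b0) \<delta> (signs H (a', b0))" if "a' \<in> A0 - {a}" for a'
      using w[OF a] that by (simp add: joint_lineality_def)
    then show "w a \<notin> lineality (signs Q b0) \<delta> (signs H (a, b0))"
      using w[OF a] by (auto simp: joint_lineality_def)
  qed (use \<delta> fin in auto)
  then have card: "card A0 \<le> s" by (rule s)
  obtain ys where ys: "set ys = A0" "length ys = card A0"
    using finite_distinct_list[OF fin] distinct_card by metis
  obtain a0 where a0: "a0 \<in> A" using A(2) by blast
  \<comment> \<open>Repeating a point of \<open>A\<close> brings the length to exactly
    \<open>s\<close>, so that the lists are counted by \<open>card A ^ s\<close>.\<close>
  define xs where "xs = ys @ replicate (s - card A0) a0"
  have xs: "length xs = s" "set xs \<subseteq> A" "A0 \<subseteq> set xs"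
    using ys card A0(1) a0 by (auto simp: xs_def)
  have "?W (set xs) = ?W A"
    using joint_lineality_antimono[OF xs(2)] joint_lineality_antimono[OF xs(3)] A0(2) by blast
  then show ?thesis using xs(1,2) by blast
qed

text \<open>Over the zero vector the germ records the signs of all linear parts, which determine the
  germ over every \<open>\<sigma>\<close>. Thus a direction can be encoded without its base
  point.\<close>

lemma germ_signs_cong:
  assumes "germ_signs H (\<lambda>_. 0) z = germ_signs H (\<lambda>_. 0) z'"
  shows "germ_signs H \<sigma> z = germ_signs H \<sigma> z'"
proof
  fix h
  have "germ_signs H (\<lambda>_. 0) y h = (if h \<in> H then sgn (fst h \<bullet> y) else 0)" for y
    by (simp add: germ_signs_def)
  from this[of z] this[of z'] have "h \<in> H \<Longrightarrow> sgn (fst h \<bullet> z) = sgn (fst h \<bullet> z')"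
    using fun_cong[OF assms, of h] by presburger
  then show "germ_signs H \<sigma> z h = germ_signs H \<sigma> z' h"
    by (simp add: germ_signs_def)
qed

text \<open>
  A trace is determined by its base point and a sign vector, and the base point by finite data
  together with \<open>s\<close> points of \<open>A\<close>.
\<close>
lemma card_traces_upper_bound:
  assumes s: "\<And>r. admits_independent_points r \<Longrightarrow> r \<le> s"
  shows "\<exists>K. \<forall>A. finite A \<longrightarrow> A \<noteq> {} \<longrightarrow> card (trace_on system A) \<le> card A ^ s * K"
proof -
  let ?V = "sign_vectors H" and ?U = "sign_vectors Q"
  \<comment> \<open>These are the data whose number does not depend on \<open>A\<close>: sign
    vectors at the \<open>s\<close> chosen points, of the cell, of the base point and of the
    direction.\<close>
  define T where "T = {\<tau>s. set \<tau>s \<subseteq> ?V \<and> length \<tau>s = s} \<times> ?U \<times> ?U \<times> ?V"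
  have finT: "finite T"
    unfolding T_def using finite_sign_vectors[OF finite_H] finite_sign_vectors[OF finite_Q]
    by (intro finite_SigmaI finite_lists_length_eq)
  have "card (trace_on system A) \<le> card A ^ s * card T" if A: "finite A" "A \<noteq> {}" for A
  proof -
    define good where "good = (\<lambda>X b0 \<delta> u xs. \<delta> \<in> ?U \<and> length xs = s \<and> set xs \<subseteq> A \<and>
      X = {a\<in>A. germ_signs H (signs H (a, b0)) (0, u) \<in> \<Z>} \<and>
      (\<forall>w\<in>joint_lineality b0 \<delta> (set xs). b0 \<bullet> w = 0))"
    have "\<exists>b0 \<delta> u xs. good X b0 \<delta> u xs" if X: "X \<in> trace_on system A" for X
    proof -
      obtain b0 \<delta> u where b0: "\<delta> \<in> \<Y>" "germ_signs Q (signs Q b0) u = \<delta>" "\<delta> \<in> ?U"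
        "X = {a\<in>A. germ_signs H (signs H (a, b0)) (0, u) \<in> \<Z>}"
        "\<And>w. w \<in> joint_lineality b0 \<delta> A \<Longrightarrow> b0 \<bullet> w = 0"
        by (rule trace_base_point[OF A(1) X]) (rule that)
      obtain xs where "length xs = s" "set xs \<subseteq> A" "joint_lineality b0 \<delta> (set xs) = joint_lineality b0 \<delta> A"
        using joint_lineality_attained[OF A b0(1,2) s] by blast
      then have "good X b0 \<delta> u xs" using b0 by (simp add: good_def)
      then show ?thesis by blast
    qed
    then obtain b0 \<delta> u xs where good: "\<And>X. X \<in> trace_on system A \<Longrightarrow> good X (b0 X) (\<delta> X) (u X) (xs X)"
      by metis
    define code where "code = (\<lambda>X. (xs X, map (\<lambda>a. signs H (a, b0 X)) (xs X), \<delta> X, signs Q (b0 X),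
      germ_signs H (\<lambda>_. 0) (0, u X)))"
    have "inj_on code (trace_on system A)"
    proof (rule inj_onI)
      fix X X' assume X: "X \<in> trace_on system A" "X' \<in> trace_on system A" and eq: "code X = code X'"
      have xs: "xs X' = xs X" and \<delta>: "\<delta> X' = \<delta> X" and \<kappa>: "signs Q (b0 X') = signs Q (b0 X)"
        and \<tau>: "\<And>a. a \<in> set (xs X) \<Longrightarrow> signs H (a, b0 X') = signs H (a, b0 X)"
        and u: "germ_signs H (\<lambda>_. 0) (0, u X') = germ_signs H (\<lambda>_. 0) (0, u X)"
        using eq by (auto simp: code_def)
      define W where "W = joint_lineality (b0 X) (\<delta> X) (set (xs X))"
      have W': "joint_lineality (b0 X') (\<delta> X') (set (xs X')) = W"
        using xs \<delta> \<kappa> \<tau> by (simp add: W_def joint_lineality_def)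
      \<comment> \<open>For equal codes, forms vanishing at one base point, or at a chosen point
        over it, vanish at the other too. So \<open>w\<close> lies in \<open>W\<close>, to which
        both base points are orthogonal, and \<open>w \<bullet> w = 0\<close>.\<close>
      define w where "w = b0 X - b0 X'"
      have flat: "w \<in> flat (signs Q (b0 X))"
        unfolding flat_def
      proof safe
        fix p c assume q: "(p, c) \<in> Q" "signs Q (b0 X) (p, c) = 0"
        then have "signs Q (b0 X') (p, c) = 0" using \<kappa> by simp
        then show "fst (p, c) \<bullet> w = 0"
          using q by (simp add: signs_eq_0_iff w_def inner_diff_right)
      qed
      have "w \<in> lineality (signs Q (b0 X)) (\<delta> X) (signs H (a, b0 X))" if a: "a \<in> set (xs X)" for a
      proof -
        have zero: "fst h \<bullet> (0, w) = 0" if h: "h \<in> H" "signs H (a, b0 X) h = 0" for h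
        proof -
          have "signs H (a, b0 X') h = 0" using \<tau>[OF a] h by simp
          then have "fst h \<bullet> ((a, b0 X) - (a, b0 X')) = 0"
            using h unfolding inner_diff_right by (simp add: signs_eq_0_iff)
          then show ?thesis by (simp add: w_def)
        qed
        have "germ_signs H (signs H (a, b0 X)) (v, u + x *\<^sub>R w) = germ_signs H (signs H (a, b0 X)) (v, u)" for v u x
        proof -
          have shift: "(v, u + x *\<^sub>R w) = (v, u) + x *\<^sub>R (0, w)" by simp
          have "fst h \<bullet> (z + x *\<^sub>R (0, w)) = fst h \<bullet> z" if "h \<in> H" "signs H (a, b0 X) h = 0" for h z
            unfolding inner_add_right inner_scaleR_right zero[OF that] by simp
          then show ?thesis unfolding shift germ_signs_def by (intro ext) (simp del: add_Pair scaleR_Pair)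
        qed
        then show ?thesis using flat by (simp add: lineality_def)
      qed
      then have "w \<in> W" using flat by (simp add: W_def joint_lineality_def)
      then have "b0 X \<bullet> w = 0" "b0 X' \<bullet> w = 0"
        using good[OF X(1)] good[OF X(2)] W' by (auto simp: good_def W_def)
      then have "w \<bullet> w = 0" unfolding w_def by (simp add: inner_diff_left)
      then have "b0 X = b0 X'" by (simp add: w_def)
      then show "X = X'"
        using good[OF X(1)] good[OF X(2)] germ_signs_cong[OF u] unfolding good_def by simp
    qed
    moreover have "code ` trace_on system A \<subseteq> {xs. set xs \<subseteq> A \<and> length xs = s} \<times> T"
    proof (rule image_subsetI)
      fix X assume "X \<in> trace_on system A"
      from good[OF this] have g: "\<delta> X \<in> ?U" "length (xs X) = s" "set (xs X) \<subseteq> A" by (auto simp: good_def)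
      have "germ_signs H (\<lambda>_. 0) z \<in> ?V" for z
        using sgn_cases by (auto simp: germ_signs_def sign_vectors_def)
      then show "code X \<in> {xs. set xs \<subseteq> A \<and> length xs = s} \<times> T"
        using g by (auto simp: code_def T_def signs_in_sign_vectors)
    qed
    moreover have "finite ({xs. set xs \<subseteq> A \<and> length xs = s} \<times> T)"
      using finT finite_lists_length_eq[OF A(1)] by blast
    ultimately have "card (trace_on system A) \<le> card ({xs. set xs \<subseteq> A \<and> length xs = s} \<times> T)"
      by (rule card_inj_on_le)
    then show ?thesis using A(1) by (simp add: card_cartesian_product card_lists_length_eq)
  qed
  then show ?thesis by blast
qed

section \<open>The exponent and the two constants\<close>

lemma admits_independent_points_0:
  assumes "signs Q b \<in> \<Y>"
  shows "admits_independent_points 0"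
proof -
  have "germ_signs Q (signs Q b) 0 = signs Q b"
    by (auto simp: germ_signs_def fun_eq_iff signs_def)
  with assms have "signs Q b \<in> \<Y> \<and> germ_signs Q (signs Q b) 0 = signs Q b \<and>
      finite ({} :: 'a set) \<and> card ({} :: 'a set) = 0" by simp
  then show ?thesis
    unfolding admits_independent_points_def by (metis empty_iff)
qed

theorem shatter_function_asymptotics:
  assumes ne: "signs Q b \<in> \<Y>" and inf: "infinite (UNIV :: 'a set)"
  shows "\<exists>C1 C2 :: real. \<exists>s \<le> DIM('b). C1 > 0 \<and> C2 > 0 \<and> (\<forall>t \<ge> 1.
    C1 * real t ^ s < real (shatter_function UNIV system t) \<and>
    real (shatter_function UNIV system t) < C2 * real t ^ s)"
proof -
  obtain s where count: "admits_independent_points s" and s: "\<And>r. admits_independent_points r \<Longrightarrow> r \<le> s"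
    using GreatestI_nat[of admits_independent_points, OF admits_independent_points_0[OF ne] admits_independent_points_le_dim]
      Greatest_le_nat[of admits_independent_points, OF _ admits_independent_points_le_dim] by (rule that)
  obtain K where K: "\<And>A. finite A \<Longrightarrow> A \<noteq> {} \<Longrightarrow> card (trace_on system A) \<le> card A ^ s * K"
    using card_traces_upper_bound[OF s] by blast
  have upper: "real (shatter_function UNIV system t) < (real K + 1) * real t ^ s" if t: "t \<ge> 1" for t
  proof -
    obtain A :: "'a set" where A: "finite A" "card A = t" "shatter_function UNIV system t = card (trace_on system A)"
      using shatter_function_attained[OF inf] by blast
    then have "A \<noteq> {}" using t by auto
    then have "shatter_function UNIV system t \<le> t ^ s * K" using K[of A] A by simp
    then have "real (shatter_function UNIV system t) \<le> real t ^ s * real K"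
      by (metis of_nat_le_iff of_nat_mult of_nat_power)
    also have "\<dots> < (real K + 1) * real t ^ s" using t by (simp add: algebra_simps)
    finally show ?thesis .
  qed
  have lower: "k ^ s \<le> shatter_function UNIV system t" if "s * k \<le> t" for k t
  proof -
    obtain A where A: "finite A" "card A \<le> s * k" "k ^ s \<le> card (trace_on system A)"
      using card_traces_lower_bound[OF count] by blast
    then show ?thesis
      using card_trace_on_le_shatter_function[OF inf A(1), of t system] that by linarith
  qed
  have pos: "1 \<le> shatter_function UNIV system t" for t
  proof -
    have "trace_on system {} \<noteq> {}" using ne by (auto simp: trace_on_def system_def)
    then have "1 \<le> card (trace_on system {})"
      using finite_trace_on[of "{}" system] by (simp add: Suc_le_eq card_gt_0_iff)
    then show ?thesis using card_trace_on_le_shatter_function[OF inf, of "{}" t system] by simp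
  qed
  \<comment> \<open>The final factor \<open>1 / 2\<close> turns a weak lower bound into a strict
    one.\<close>
  define C where "C = (1 / (2 * (real s + 1))) ^ s / 2"
  have "C * real t ^ s < real (shatter_function UNIV system t)" if t: "t \<ge> 1" for t
  proof -
    \<comment> \<open>The divisor \<open>s + 1\<close> is nonzero also for \<open>s = 0\<close>. If
      \<open>k = 0\<close>, the bound by 1 from \<open>pos\<close> replaces the one by
      \<open>k ^ s\<close>.\<close>
    define k where "k = t div (s + 1)"
    have "real t / (2 * (real s + 1)) \<le> max 1 (real k)"
    proof (cases "k = 0")
      case True
      then have "t < s + 1" by (simp add: k_def div_eq_0_iff)
      then have "real t / (2 * (real s + 1)) \<le> 1" by (simp add: field_simps)
      then show ?thesis by (rule max.coboundedI1)
    next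
      case False
      have "t < (s + 1) * (k + 1)"
        using dividend_less_times_div[of "s + 1" t] by (simp add: k_def)
      also have "\<dots> \<le> (s + 1) * (2 * k)" using False by (intro mult_left_mono) auto
      finally have "real t < real ((s + 1) * (2 * k))" by (simp only: of_nat_less_iff)
      then have "real t / (2 * (real s + 1)) \<le> real k" by (simp add: field_simps)
      then show ?thesis by (rule max.coboundedI2)
    qed
    then have "(real t / (2 * (real s + 1))) ^ s \<le> (max 1 (real k)) ^ s"
      by (intro power_mono) auto
    also have "\<dots> \<le> real (shatter_function UNIV system t)"
    proof -
      have "s * k \<le> t" unfolding k_def
        by (metis div_times_less_eq_dividend le_add1 le_trans mult.commute mult_le_mono2)
      then have "real (k ^ s) \<le> real (shatter_function UNIV system t)"
        using lower by (simp only: of_nat_le_iff)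
      then show ?thesis using pos[of t] by (auto simp: max_def)
    qed
    finally have "2 * C * real t ^ s \<le> real (shatter_function UNIV system t)"
      by (simp add: C_def power_divide)
    moreover have "C > 0" by (simp add: C_def add_nonneg_pos)
    then have "C * real t ^ s > 0" using t by simp
    ultimately show ?thesis by linarith
  qed
  moreover have "C > 0" by (simp add: C_def add_nonneg_pos)
  moreover have "s \<le> DIM('b)" using count by (rule admits_independent_points_le_dim)
  ultimately show ?thesis using upper by (intro exI[of _ C] exI[of _ "real K + 1"] exI[of _ s]) auto
qed

end

section \<open>From semilinear set systems to sign systems\<close>

text \<open>\<open>Q\<close> joins forms deciding membership in \<open>Y\<close> with those obtained
  by elimination, the latter providing \<open>lift\<close>. As \<open>Y\<close> and the total set
  are unions of sign cells, each is recovered from the sign vectors it realises.\<close>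

lemma semilinear_set_system_signs:
  assumes "semilinear_set_system \<S> Y"
  obtains H Q \<Z> \<Y> where "sign_system H Q" "\<S> = sign_system.system H Q \<Z> \<Y>" "Y = {b. signs Q b \<in> \<Y>}"
proof -
  obtain S where S: "\<S> = {S b | b. b \<in> Y}" "semilinear Y" "semilinear {(a, b). a \<in> S b \<and> b \<in> Y}"
    using assms unfolding semilinear_set_system_def by blast
  define Z where "Z = {(a, b). a \<in> S b \<and> b \<in> Y}"
  obtain H where H: "finite H" "\<And>z z'. signs H z = signs H z' \<Longrightarrow> z \<in> Z \<Longrightarrow> z' \<in> Z"
    using semilinear_signs[OF S(3)] unfolding Z_def by blast
  obtain Q1 where Q1: "finite Q1" "\<And>b b'. signs Q1 b = signs Q1 b' \<Longrightarrow> b \<in> Y \<Longrightarrow> b' \<in> Y"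
    using semilinear_signs[OF S(2)] by blast
  obtain Q2 where Q2: "finite Q2" "\<And>b b' a. signs Q2 b = signs Q2 b' \<Longrightarrow> \<exists>a'. signs H (a', b') = signs H (a, b)"
    using signs_eliminate_fst[OF H(1)] by blast
  interpret sign_system H "Q1 \<union> Q2" "signs H ` Z" "signs (Q1 \<union> Q2) ` Y"
  proof
    show "\<exists>a'. signs H (a', b') = signs H (a, b)" if "signs (Q1 \<union> Q2) b = signs (Q1 \<union> Q2) b'" for b b' a
      using Q2(2)[OF signs_eq_mono[OF that]] by blast
  qed (use H(1) Q1(1) Q2(1) in auto)
  have Y: "signs (Q1 \<union> Q2) b \<in> signs (Q1 \<union> Q2) ` Y \<longleftrightarrow> b \<in> Y" for b
  proof
    assume "signs (Q1 \<union> Q2) b \<in> signs (Q1 \<union> Q2) ` Y"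
    then obtain b' where "b' \<in> Y" "signs (Q1 \<union> Q2) b' = signs (Q1 \<union> Q2) b" by force
    then show "b \<in> Y" using Q1(2) signs_eq_mono[of "Q1 \<union> Q2" b' b Q1] by blast
  qed blast
  have Z: "signs H z \<in> signs H ` Z \<longleftrightarrow> z \<in> Z" for z
  proof
    assume "signs H z \<in> signs H ` Z"
    then obtain z' where "z' \<in> Z" "signs H z' = signs H z" by force
    then show "z \<in> Z" using H(2) by blast
  qed blast
  have "S b = {a. (a, b) \<in> Z}" if "b \<in> Y" for b using that by (auto simp: Z_def)
  then have "(\<exists>b. X = S b \<and> b \<in> Y) \<longleftrightarrow> (\<exists>b. X = {a. (a, b) \<in> Z} \<and> b \<in> Y)" for X by metis
  then have "\<S> = system"
    unfolding system_def Y Z S(1) by (intro Collect_cong)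
  moreover have "Y = {b. signs (Q1 \<union> Q2) b \<in> signs (Q1 \<union> Q2) ` Y}" using Y by blast
  ultimately show ?thesis by (rule that[OF sign_system_axioms])
qed

theorem theorem1p1:
  fixes \<S> :: "(real ^ 'm) set set" and Y :: "(real ^ 'n) set"
  assumes "semilinear_set_system \<S> Y"
    and "Y \<noteq> {}"
  shows "\<exists>C1 C2 :: real. \<exists>s :: nat. C1 > 0 \<and> C2 > 0 \<and> s \<le> CARD('n) \<and>
    (\<forall>t :: nat. t \<ge> 1 \<longrightarrow>
       C1 * real t ^ s < real (shatter_function UNIV \<S> t) \<and>
       real (shatter_function UNIV \<S> t) < C2 * real t ^ s)"
proof -
  obtain H Q \<Z> \<Y> where *: "sign_system H Q" "\<S> = sign_system.system H Q \<Z> \<Y>" "Y = {b. signs Q b \<in> \<Y>}"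
    using semilinear_set_system_signs[OF assms(1)] by blast
  obtain b where "signs Q b \<in> \<Y>" using assms(2) *(3) by blast
  from sign_system.shatter_function_asymptotics[OF *(1) this, of \<Z>] show ?thesis
    unfolding *(2)[symmetric] by (auto simp: infinite_UNIV_char_0)
qed

end
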